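(* Let $n$ be even and let $c\ge 2$ be an even integer such that $n/c$ is an even integer. Let $\alpha=(1/c)^{1/(4c)}$, let $\beta$ satisfy $\alpha<\beta<1$, and let $\delta\in(0,1)$ satisfy $2^{\delta}\beta<1$. In the mirror game on $\{1,\ldots,2n\}$, if Alice is open-book (has no secrets) and has memory of at most $\delta\cdot 2n$ bits, then there exists a strategy for Bob against which Alice loses with probability at least $$1-\left(\frac{n+1}{2n+1}\right)^{c/2}-\nu(n),$$ where $\nu$ is a negligible function.
   Context: Mirror game: Alice and Bob alternately name numbers from $\{1,2,\ldots,2n\}$, Alice on odd turns $1,3,\ldots$ and Bob on even turns $2,4,\ldots$. A player who names a number that was named before loses (and the other wins); if all $2n$ turns pass without repetition the game is a draw. Open-book Alice with $m$ bits of memory: she has a memory state $x\in\{0,1\}^m$; at the end of each turn $2i$ she draws a fresh random string $r_i$ (of arbitrary length) and from then on has access to all of $(r_1,\ldots,r_i)$. Her strategy consists of a next-move function giving her move from her current memory state and random strings drawn so far, and a state-transition function giving her new memory state from Bob's last move, her current memory state, the turn number and the random strings drawn so far. Bob knows Alice's strategy (both functions), and at every moment knows her current memory state and all random strings she has drawn so far, but not her future random strings; Bob may use his own random coins. A function $f:\mathbb{N}\to\mathbb{R}$ is negligible if for every positive integer $c$ there is $N_c$ with $|f(x)|<x^{-c}$ for all $x>N_c$. *)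

theory Defs
  imports "HOL-Probability.Probability"
begin

text \<open>
  Bit strings are boolean lists. The list \<open>rs\<close> of random strings is \<open>[r\<^sub>1, r\<^sub>2, \<dots>]\<close>, so
  \<open>rs ! i\<close> is \<open>r\<^bsub>i+1\<^esub>\<close> and \<open>take i rs\<close> is what has been drawn by the end of turn \<open>2 i\<close>.

  \<open>rand_len A i\<close> is the length of \<open>r\<^sub>i\<close>. \<open>next_move A x rs\<close> is Alice's move in memory state
  \<open>x\<close> after drawing exactly the strings \<open>rs\<close>. \<open>transition A y x t rs\<close> is her memory state
  after turn \<open>t\<close> (an even number), in which Bob named \<open>y\<close>; here \<open>rs\<close> already contains the
  string drawn at the end of turn \<open>t\<close>.
\<close>

record alice_strategy =
  init_state :: "bool list"
  rand_len :: "nat \<Rightarrow> nat"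
  next_move :: "bool list \<Rightarrow> bool list list \<Rightarrow> nat"
  transition :: "nat \<Rightarrow> bool list \<Rightarrow> nat \<Rightarrow> bool list list \<Rightarrow> bool list"

definition valid_alice :: "nat \<Rightarrow> nat \<Rightarrow> alice_strategy \<Rightarrow> bool" where
  "valid_alice n m A \<longleftrightarrow>
     length (init_state A) = m \<and>
     (\<forall>x rs. length x = m \<longrightarrow> next_move A x rs \<in> {1..2 * n}) \<and>
     (\<forall>y x t rs. y \<in> {1..2 * n} \<longrightarrow> length x = m \<longrightarrow> length (transition A y x t rs) = m)"

text \<open>
  Bob's private coins are drawn once, before the game, from an arbitrary discrete distribution;
  Alice never sees them. \<open>bob_move B b xs rs ws\<close> is Bob's move with coins \<open>b\<close> when \<open>xs\<close> are all
  memory states Alice has been in (the last one is her current state), \<open>rs\<close> are all random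
  strings she has drawn so far, and \<open>ws\<close> are all numbers named so far. That Bob knows Alice's
  strategy is expressed by choosing \<open>B\<close> after \<open>A\<close>.
\<close>

record bob_strategy =
  coins :: "nat pmf"
  bob_move :: "nat \<Rightarrow> bool list list \<Rightarrow> bool list list \<Rightarrow> nat list \<Rightarrow> nat"

definition valid_bob :: "nat \<Rightarrow> bob_strategy \<Rightarrow> bool" where
  "valid_bob n B \<longleftrightarrow> (\<forall>b xs rs ws. bob_move B b xs rs ws \<in> {1..2 * n})"

text \<open>
  \<open>play A B b rs i\<close> consists of Alice's memory states and the numbers named, both in
  chronological order, after \<open>2 i\<close> turns. Play formally continues after a repetition; only the
  first repetition decides the outcome, see \<open>alice_loses\<close>.
\<close>

fun play :: "alice_strategy \<Rightarrow> bob_strategy \<Rightarrow> nat \<Rightarrow> bool list list \<Rightarrow> nat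
    \<Rightarrow> bool list list \<times> nat list" where
  "play A B b rs 0 = ([init_state A], [])"
| "play A B b rs (Suc i) =
    (let (xs, ws) = play A B b rs i;
         x = last xs;
         a = next_move A x (take i rs);
         y = bob_move B b xs (take i rs) (ws @ [a]);
         x' = transition A y x (2 * Suc i) (take (Suc i) rs)
     in (xs @ [x'], ws @ [a, y]))"

text \<open>
  The first repetition occurs in one of Alice's turns. The index \<open>k\<close> corresponds to turn \<open>k + 1\<close>,
  so Alice's turns are the even indices.
\<close>

definition alice_loses :: "nat list \<Rightarrow> bool" where
  "alice_loses ws \<longleftrightarrow>
     (\<exists>k < length ws. even k \<and> distinct (take k ws) \<and> ws ! k \<in> set (take k ws))"

text \<open>
  The uniform distribution on this product set makes \<open>r\<^sub>1, \<dots>, r\<^sub>n\<close> independent and each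
  \<open>r\<^sub>i\<close> uniform.
\<close>

definition rand_strings :: "nat \<Rightarrow> alice_strategy \<Rightarrow> bool list list set" where
  "rand_strings n A = {rs. length rs = n \<and> (\<forall>i<n. length (rs ! i) = rand_len A (Suc i))}"

lemma rand_strings_nonempty: "rand_strings n A \<noteq> {}"
proof -
  have "map (\<lambda>i. replicate (rand_len A (Suc i)) False) [0..<n] \<in> rand_strings n A"
    by (simp add: rand_strings_def)
  then show ?thesis by blast
qed

lemma finite_rand_strings: "finite (rand_strings n A)"
proof -
  let ?S = "\<Union>i<n. {s :: bool list. set s \<subseteq> UNIV \<and> length s = rand_len A (Suc i)}"
  have "finite ?S"
    by (intro finite_UN_I finite_lists_length_eq) auto
  then have "finite {rs. set rs \<subseteq> ?S \<and> length rs = n}"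
    by (rule finite_lists_length_eq)
  moreover have "rand_strings n A \<subseteq> {rs. set rs \<subseteq> ?S \<and> length rs = n}"
    by (fastforce simp: rand_strings_def in_set_conv_nth)
  ultimately show ?thesis
    by (rule finite_subset[rotated])
qed

definition prob_alice_loses :: "nat \<Rightarrow> alice_strategy \<Rightarrow> bob_strategy \<Rightarrow> real" where
  "prob_alice_loses n A B =
     measure_pmf.prob (pair_pmf (coins B) (pmf_of_set (rand_strings n A)))
       {(b, rs). alice_loses (snd (play A B b rs n))}"

definition negligible_fun :: "(nat \<Rightarrow> real) \<Rightarrow> bool" where
  "negligible_fun f \<longleftrightarrow>
     (\<forall>c::nat. c > 0 \<longrightarrow> (\<exists>N::nat. \<forall>x>N. \<bar>f x\<bar> < real x powr (- real c)))"

end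

theory Submission
  imports Defs "HOL-Real_Asymp.Real_Asymp"
begin

text \<open>
  Write \<open>n = 4 H K\<close> with \<open>c = 2 H\<close>. Suppose that two possible sets \<open>S \<noteq> S'\<close> of equal size and with
  \<open>\<bar>S \<inter> S'\<bar>\<close> even leave Alice in the same memory state with the same open coins. If Bob avoids
  \<open>S \<union> S'\<close>, parity forces Alice to be the first to name one of its elements, and she then loses
  in at least one of the two cases. If she survives, Bob answers inside \<open>S - S'\<close> or \<open>S' - S\<close>
  and parity is restored, so several such ambiguous pairs can be exploited one after the other,
  each with failure probability \<open>1/2\<close>.

  Each pair is created by a phase of \<open>K\<close> rounds in which Bob plays at random outside
  everything that is ambiguous. Sets that are never confused with one another have even size and
  pairwise odd intersections, so there are at most \<open>2 n + 1\<close> of them per memory state, whereas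
  a phase produces at least \<open>c ^ K\<close> different sets. As \<open>2 ^ m \<le> 2 powr (2 \<delta> n)\<close> is
  exponentially smaller than \<open>c ^ K = \<alpha> powr (- 2 n)\<close>, a phase fails with negligible
  probability.

  Rather than conditioning on what Alice knows, the proof bounds the sum of Bob's optimal winning
  probabilities over all ambiguous pasts; this also makes Bob's strategy deterministic.
\<close>

section \<open>The game as a decision process for Bob\<close>

definition avg :: "'a set \<Rightarrow> ('a \<Rightarrow> real) \<Rightarrow> real" where
  "avg S f = (\<Sum>s\<in>S. f s) / real (card S)"

lemma avg_mono:
  assumes "\<And>s. s \<in> S \<Longrightarrow> f s \<le> g s"
  shows "avg S f \<le> avg S g"
  unfolding avg_def by (intro divide_right_mono sum_mono assms) auto

lemma avg_const: "finite S \<Longrightarrow> S \<noteq> {} \<Longrightarrow> avg S (\<lambda>_. b) = b"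
  by (simp add: avg_def)

lemma avg_le:
  assumes "finite S" "S \<noteq> {}" "\<And>s. s \<in> S \<Longrightarrow> f s \<le> b"
  shows "avg S f \<le> b"
  using avg_mono[of S f "\<lambda>_. b"] assms by (simp add: avg_const)

lemma avg_ge:
  assumes "finite S" "S \<noteq> {}" "\<And>s. s \<in> S \<Longrightarrow> b \<le> f s"
  shows "b \<le> avg S f"
  using avg_mono[of S "\<lambda>_. b" f] assms by (simp add: avg_const)

lemma avg_sum: "avg S (\<lambda>s. \<Sum>t\<in>T. f t s) = (\<Sum>t\<in>T. avg S (f t))"
  unfolding avg_def by (subst sum.swap) (simp add: sum_divide_distrib)

lemma avg_diff_const:
  assumes "finite S" "S \<noteq> {}"
  shows "avg S (\<lambda>s. b - f s) = b - avg S f"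
  using assms by (simp add: avg_def sum_subtractf diff_divide_distrib)

definition strings :: "alice_strategy \<Rightarrow> nat \<Rightarrow> bool list set" where
  "strings A i = {r. length r = rand_len A i}"

lemma finite_strings [simp]: "finite (strings A i)"
  using finite_lists_length_eq[of "UNIV :: bool set" "rand_len A i"] by (simp add: strings_def)

lemma strings_nonempty [simp]: "strings A i \<noteq> {}"
  using Ex_list_of_length by (auto simp: strings_def)

text \<open>The possible strings after \<open>i\<close> have been drawn, built from the front so
  that averages split off the next string just as the recursion for \<open>win_prob\<close>
  does.\<close>

primrec tails :: "alice_strategy \<Rightarrow> nat \<Rightarrow> nat \<Rightarrow> bool list list set" where
  "tails A i 0 = {[]}"
| "tails A i (Suc k) = (\<lambda>(r, e). r # e) ` (strings A (Suc i) \<times> tails A (Suc i) k)"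

lemma tails_eq:
  "tails A i k = {e. length e = k \<and> (\<forall>j<k. length (e ! j) = rand_len A (Suc (i + j)))}"
proof (induction k arbitrary: i)
  case 0
  then show ?case by auto
next
  case (Suc k)
  have "e \<in> tails A i (Suc k) \<longleftrightarrow>
      length e = Suc k \<and> (\<forall>j<Suc k. length (e ! j) = rand_len A (Suc (i + j)))" for e
  proof (cases e)
    case Nil
    then show ?thesis by auto
  next
    case (Cons r e')
    then show ?thesis
      by (auto simp: Suc strings_def image_iff All_less_Suc2)
  qed
  then show ?case by blast
qed

lemma finite_tails [simp]: "finite (tails A i k)"
  by (induction k arbitrary: i) auto

lemma tails_nonempty [simp]: "tails A i k \<noteq> {}"
  by (induction k arbitrary: i) auto

lemma avg_tails_Suc:
  "avg (tails A i (Suc k)) f = avg (strings A (Suc i)) (\<lambda>r. avg (tails A (Suc i) k) (\<lambda>e. f (r # e)))"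
proof -
  have inj: "inj_on (\<lambda>(r, e). r # e) (strings A (Suc i) \<times> tails A (Suc i) k)"
    by (auto simp: inj_on_def)
  show ?thesis
    unfolding avg_def tails.simps sum.reindex[OF inj] card_image[OF inj]
    by (simp add: case_prod_unfold o_def card_cartesian_product sum.cartesian_product
        flip: sum_divide_distrib)
qed

text \<open>
  An open-book Alice hides only her future coins, so the game is a Markov decision process for
  Bob, whose optimal value is computed here.
\<close>

definition reply_value ::
  "alice_strategy \<Rightarrow> (bool list \<Rightarrow> nat set \<Rightarrow> bool list list \<Rightarrow> real) \<Rightarrow>
    bool list \<Rightarrow> nat set \<Rightarrow> bool list list \<Rightarrow> nat \<Rightarrow> real" where
  "reply_value A v x W rs y =
     (let a = next_move A x rs in
      if y \<in> insert a W then 0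
      else avg (strings A (Suc (length rs)))
        (\<lambda>r. v (transition A y x (2 * Suc (length rs)) (rs @ [r])) (W \<union> {a, y}) (rs @ [r])))"

text \<open>\<open>k\<close> rounds remain. A draw counts 0 for Bob, since only a loss of Alice is
  of value. The numbers named so far enter only through their set \<open>W\<close>.\<close>

primrec win_prob ::
  "nat \<Rightarrow> alice_strategy \<Rightarrow> nat \<Rightarrow> bool list \<Rightarrow> nat set \<Rightarrow> bool list list \<Rightarrow> real" where
  "win_prob n A 0 = (\<lambda>x W rs. 0)"
| "win_prob n A (Suc k) = (\<lambda>x W rs.
     if next_move A x rs \<in> W then 1
     else Max (reply_value A (win_prob n A k) x W rs ` {1..2 * n}))"

lemma win_prob_bounds:
  assumes "n > 0"
  shows "0 \<le> win_prob n A k x W rs \<and> win_prob n A k x W rs \<le> 1"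
proof (induction k arbitrary: x W rs)
  case 0
  then show ?case by simp
next
  case (Suc k)
  have *: "0 \<le> reply_value A (win_prob n A k) x W rs y \<and>
      reply_value A (win_prob n A k) x W rs y \<le> 1" for y
    using Suc by (auto simp: reply_value_def Let_def intro!: avg_le avg_ge)
  have "Max (reply_value A (win_prob n A k) x W rs ` {1..2 * n})
      \<in> reply_value A (win_prob n A k) x W rs ` {1..2 * n}"
    using assms by (intro Max_in) auto
  then show ?case using * by auto
qed

text \<open>The last entry of \<open>ws\<close> is Alice's current move, which
  \<open>reply_value\<close> recomputes; hence \<open>butlast\<close>. After the present round
  \<open>n - Suc (length rs)\<close> rounds remain.\<close>

definition greedy_bob :: "nat \<Rightarrow> alice_strategy \<Rightarrow> bob_strategy" where
  "greedy_bob n A = \<lparr>coins = return_pmf 0,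
     bob_move = \<lambda>b xs rs ws.
       arg_max_on (reply_value A (win_prob n A (n - Suc (length rs))) (last xs) (set (butlast ws)) rs)
         {1..2 * n}\<rparr>"

lemma arg_max_on_Max:
  fixes f :: "'a \<Rightarrow> real"
  assumes "finite S" "S \<noteq> {}"
  shows "arg_max_on f S \<in> S" "f (arg_max_on f S) = Max (f ` S)"
proof -
  have "Max (f ` S) \<in> f ` S" using assms by simp
  then obtain s where s: "s \<in> S" "f s = Max (f ` S)" by auto
  have "is_arg_max f (\<lambda>x. x \<in> S) s"
    unfolding is_arg_max_linorder using s assms by simp
  then have *: "is_arg_max f (\<lambda>x. x \<in> S) (arg_max_on f S)"
    unfolding arg_max_on_def arg_max_def by (rule someI)
  then show "arg_max_on f S \<in> S" by (simp add: is_arg_max_def)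
  show "f (arg_max_on f S) = Max (f ` S)"
    using * s assms unfolding is_arg_max_linorder
    by (intro antisym) auto
qed

lemma play_take: "i \<le> j \<Longrightarrow> play A B b (take j rs) i = play A B b rs i"
  by (induction i) (auto simp: min_def)

lemma play_append: "length pre = i \<Longrightarrow> play A B b (pre @ e) i = play A B b pre i"
  using play_take[of i i A B b "pre @ e"] by simp

lemma play_prefix: "\<exists>us. snd (play A B b rs (i + d)) = snd (play A B b rs i) @ us"
  by (induction d) (auto simp: Let_def case_prod_unfold)

lemma alice_loses_append: "alice_loses ws \<Longrightarrow> alice_loses (ws @ us)"
  unfolding alice_loses_def by (fastforce simp: nth_append)

lemma play_lengths:
  "length (fst (play A B b rs i)) = Suc i \<and> length (snd (play A B b rs i)) = 2 * i"
  by (induction i) (auto simp: Let_def case_prod_unfold)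

text \<open>Backward induction: Bob's reply attains the maximum in \<open>win_prob\<close>, and
  averaging over Alice's next string matches averaging over \<open>tails\<close>. As
  \<open>ws\<close> is distinct, a repetition by Alice is the first one; a repetition by Bob is
  worth 0, so nothing is claimed after it.\<close>

lemma greedy_bob_achieves:
  fixes n A
  defines "B \<equiv> greedy_bob n A"
  assumes "n > 0" "k \<le> n" "length pre = n - k" "play A B b pre (n - k) = (xs, ws)" "distinct ws"
  shows "win_prob n A k (last xs) (set ws) pre
    \<le> avg (tails A (n - k) k) (\<lambda>e. of_bool (alice_loses (snd (play A B b (pre @ e) n))))"
  using assms(3-)
proof (induction k arbitrary: pre xs ws)
  case 0
  then show ?case by (auto intro: avg_ge)
next
  case (Suc k)
  define i where "i = n - Suc k"
  have i: "n - k = Suc i" "length pre = i" "n = Suc i + k"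
    using Suc.prems by (auto simp: i_def)
  define x a where "x = last xs" and "a = next_move A x pre"
  define y where "y = bob_move B b xs pre (ws @ [a])"
  define x' where "x' = (\<lambda>r. transition A y x (2 * Suc i) (pre @ [r]))"
  have len: "length ws = 2 * i"
    using play_lengths[of A B b pre i] Suc.prems(3) by (simp add: i_def)
  have step: "play A B b (pre @ [r]) (Suc i) = (xs @ [x' r], ws @ [a, y])" for r
    using Suc.prems(3) play_append[OF i(2), of A B b "[r]"] i(2)
    by (simp add: i_def[symmetric] x_def a_def y_def x'_def Let_def)
  have pre': "play A B b (pre @ r # e) (Suc i) = play A B b (pre @ [r]) (Suc i)" for r e
    using play_append[of "pre @ [r]" "Suc i" A B b e] i(2) by simp
  have final: "\<exists>us. snd (play A B b (pre @ r # e) n) = ws @ [a, y] @ us" for r e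
    using play_prefix[of A B b "pre @ r # e" "Suc i" k] unfolding pre'[of r e] step i(3)[symmetric] by simp
  show ?case
  proof (cases "a \<in> set ws")
    case True
    \<comment> \<open>Alice's move has index \<open>2 * i = length ws\<close>, and the formal
      continuation of the play cannot undo the loss.\<close>
    have "alice_loses (ws @ [a, y])"
      unfolding alice_loses_def using True Suc.prems(4) len
      by (intro exI[of _ "2 * i"]) (auto simp: nth_append)
    then have "alice_loses (snd (play A B b (pre @ r # e) n))" for r e
      using final[of r e] alice_loses_append by fastforce
    then have "1 \<le> avg (tails A i (Suc k)) (\<lambda>e. of_bool (alice_loses (snd (play A B b (pre @ e) n))))"
      by (intro avg_ge) auto
    then show ?thesis
      using win_prob_bounds[OF \<open>n > 0\<close>, of A "Suc k" "last xs" "set ws" pre]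
      unfolding i_def by linarith
  next
    case False
    let ?F = "reply_value A (win_prob n A k) x (set ws) pre"
    have "y = arg_max_on ?F {1..2 * n}"
      using i by (simp add: y_def B_def greedy_bob_def x_def)
    then have y: "?F y = Max (?F ` {1..2 * n})"
      using arg_max_on_Max(2)[of "{1..2 * n}" ?F] \<open>n > 0\<close> by simp
    have win: "win_prob n A (Suc k) (last xs) (set ws) pre = ?F y"
      using False y by (simp add: x_def a_def)
    show ?thesis
    proof (cases "y \<in> insert a (set ws)")
      case True
      then have "?F y = 0" by (simp add: reply_value_def a_def)
      then show ?thesis unfolding win by (auto intro: avg_ge)
    next
      case y': False
      have "?F y = avg (strings A (Suc i))
          (\<lambda>r. win_prob n A k (x' r) (set (ws @ [a, y])) (pre @ [r]))"
        using y' i(2) by (auto simp: reply_value_def a_def[symmetric] x'_def Let_def Un_commute)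
      also have "\<dots> \<le> avg (strings A (Suc i)) (\<lambda>r. avg (tails A (Suc i) k)
          (\<lambda>e. of_bool (alice_loses (snd (play A B b (pre @ r # e) n)))))"
      proof (rule avg_mono)
        fix r
        have "play A B b (pre @ [r]) (n - k) = (xs @ [x' r], ws @ [a, y])"
          using step i(1) by simp
        moreover have "distinct (ws @ [a, y])"
          using Suc.prems(4) False y' by auto
        ultimately show "win_prob n A k (x' r) (set (ws @ [a, y])) (pre @ [r]) \<le> avg (tails A (Suc i) k)
          (\<lambda>e. of_bool (alice_loses (snd (play A B b (pre @ r # e) n))))"
          using Suc.IH[of "pre @ [r]" "xs @ [x' r]" "ws @ [a, y]"] Suc.prems(1) i(1,2) by simp
      qed
      also have "\<dots> = avg (tails A i (Suc k))
          (\<lambda>e. of_bool (alice_loses (snd (play A B b (pre @ e) n))))"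
        by (rule avg_tails_Suc[symmetric])
      finally show ?thesis unfolding win i_def .
    qed
  qed
qed

lemma rand_strings_eq: "rand_strings n A = tails A 0 n"
  by (simp add: rand_strings_def tails_eq)

lemma prob_greedy_bob:
  assumes "n > 0"
  shows "win_prob n A n (init_state A) {} [] \<le> prob_alice_loses n A (greedy_bob n A)"
proof -
  let ?B = "greedy_bob n A"
  let ?R = "rand_strings n A"
  let ?L = "{rs. alice_loses (snd (play A ?B 0 rs n))}"
  have "pair_pmf (coins ?B) (pmf_of_set ?R) = map_pmf (Pair 0) (pmf_of_set ?R)"
    by (simp add: greedy_bob_def pair_return_pmf1)
  then have "prob_alice_loses n A ?B = measure_pmf.prob (pmf_of_set ?R) ?L"
    by (simp add: prob_alice_loses_def vimage_def)
  also have "\<dots> = real (card (?R \<inter> ?L)) / real (card ?R)"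
    by (rule measure_pmf_of_set[OF rand_strings_nonempty finite_rand_strings])
  also have "\<dots> = avg (tails A 0 n) (\<lambda>e. of_bool (alice_loses (snd (play A ?B 0 e n))))"
    unfolding rand_strings_eq avg_def by (simp add: Int_def)
  finally show ?thesis
    using greedy_bob_achieves[OF assms, of n "[]" A 0 "[init_state A]" "[]"] by simp
qed

lemma valid_greedy_bob: "n > 0 \<Longrightarrow> valid_bob n (greedy_bob n A)"
  unfolding valid_bob_def greedy_bob_def
  by (simp del: atLeastAtMost_iff add: arg_max_on_Max(1))

section \<open>Even sets with odd intersections\<close>

text \<open>A subfamily is determined by the set of points it covers an odd number of times together
  with the parity of its size: modulo 2, that set meets \<open>S\<close> in as many points as there
  are members other than \<open>S\<close>. So there are at most \<open>2 ^ Suc (card G)\<close>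
  subfamilies.\<close>

lemma even_odd_town:
  fixes \<S> :: "nat set set"
  assumes "finite G" "\<And>S. S \<in> \<S> \<Longrightarrow> S \<subseteq> G" "\<And>S. S \<in> \<S> \<Longrightarrow> even (card S)"
    and "\<And>S T. S \<in> \<S> \<Longrightarrow> T \<in> \<S> \<Longrightarrow> S \<noteq> T \<Longrightarrow> odd (card (S \<inter> T))"
  shows "finite \<S> \<and> card \<S> \<le> Suc (card G)"
proof -
  have fin: "finite \<S>"
    using assms(1,2) by (meson PowI finite_Pow_iff finite_subset subsetI)
  define f where "f = (\<lambda>\<A>. ({p \<in> G. odd (card {T \<in> \<A>. p \<in> T})}, odd (card \<A>)))"
  have mem: "S \<in> \<A> \<longleftrightarrow> odd (card (fst (f \<A>) \<inter> S)) \<noteq> snd (f \<A>)"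
    if "\<A> \<subseteq> \<S>" "S \<in> \<S>" for \<A> S
  proof -
    have finA: "finite \<A>" and finS: "finite S"
      using that fin finite_subset assms(1,2) by blast+
    have "fst (f \<A>) \<inter> S = {p \<in> S. odd (card {T \<in> \<A>. p \<in> T})}"
      using assms(2) that by (auto simp: f_def)
    then have "odd (card (fst (f \<A>) \<inter> S)) \<longleftrightarrow> odd (\<Sum>p\<in>S. card {T \<in> \<A>. p \<in> T})"
      using even_sum_iff[OF finS, of "\<lambda>p. card {T \<in> \<A>. p \<in> T}"] by simp
    \<comment> \<open>Double counting of the incidences between points of \<open>S\<close> and
      members of the subfamily.\<close>
    also have "(\<Sum>p\<in>S. card {T \<in> \<A>. p \<in> T}) = (\<Sum>p\<in>S. \<Sum>T\<in>\<A>. of_bool (p \<in> T))"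
      using finA by (intro sum.cong) (auto simp: Int_def)
    also have "\<dots> = (\<Sum>T\<in>\<A>. card (S \<inter> T))"
      using finS by (subst sum.swap) simp
    also have "odd \<dots> \<longleftrightarrow> odd (card {T \<in> \<A>. odd (card (S \<inter> T))})"
      using even_sum_iff[OF finA, of "\<lambda>T. card (S \<inter> T)"] by simp
    also have "{T \<in> \<A>. odd (card (S \<inter> T))} = \<A> - {S}"
      using assms(3,4) that by auto
    finally show ?thesis
      using finA by (cases "S \<in> \<A>") (auto simp: f_def card_gt_0_iff)
  qed
  have "inj_on f (Pow \<S>)"
    by (rule inj_onI) (metis PowD mem subset_antisym subsetI subsetD)
  moreover have "f ` Pow \<S> \<subseteq> Pow G \<times> UNIV" by (auto simp: f_def)
  ultimately have "card (Pow \<S>) \<le> card (Pow G \<times> (UNIV :: bool set))"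
    using assms(1) by (intro card_inj_on_le[of f]) auto
  then have "(2::nat) ^ card \<S> \<le> 2 ^ Suc (card G)"
    using fin assms(1) by (simp add: card_Pow card_cartesian_product)
  then have "card \<S> \<le> Suc (card G)"
    by (rule power_le_imp_le_exp[rotated]) simp
  then show ?thesis using fin by simp
qed

section \<open>Cubes of ambiguous pasts\<close>

text \<open>
  Bob confuses Alice by a cube of equally plausible pasts: the numbers in \<open>C\<close> were certainly
  named, and of each pair in \<open>\<P>\<close> exactly one component was named.
\<close>

definition scenario :: "nat set \<Rightarrow> (nat set \<times> nat set) set \<Rightarrow> (nat set \<times> nat set) set \<Rightarrow> nat set" where
  "scenario C \<P> T = C \<union> (\<Union>p\<in>\<P>. if p \<in> T then fst p else snd p)"

definition touched :: "nat set \<Rightarrow> (nat set \<times> nat set) set \<Rightarrow> nat set" where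
  "touched C \<P> = C \<union> (\<Union>p\<in>\<P>. fst p \<union> snd p)"

text \<open>Even sizes carry Bob's parity argument, and equal sizes within a pair make all scenarios
  equally large. The bound \<open>2 * K\<close> keeps enough numbers untouched for further
  phases.\<close>

definition cube :: "nat \<Rightarrow> nat \<Rightarrow> nat set \<Rightarrow> (nat set \<times> nat set) set \<Rightarrow> bool" where
  "cube n K C \<P> \<longleftrightarrow>
     finite \<P> \<and> C \<subseteq> {1..2 * n} \<and> even (card C) \<and>
     (\<forall>p\<in>\<P>. fst p \<subseteq> {1..2 * n} \<and> snd p \<subseteq> {1..2 * n} \<and> fst p \<inter> snd p = {} \<and>
        card (snd p) = card (fst p) \<and> even (card (fst p)) \<and> fst p \<noteq> {} \<and>
        card (fst p) \<le> 2 * K \<and> C \<inter> (fst p \<union> snd p) = {}) \<and>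
     (\<forall>p\<in>\<P>. \<forall>q\<in>\<P>. p \<noteq> q \<longrightarrow> (fst p \<union> snd p) \<inter> (fst q \<union> snd q) = {})"

text \<open>The common size of all scenarios of a cube, that is, how many numbers have been
  named.\<close>

definition scenario_size :: "nat set \<Rightarrow> (nat set \<times> nat set) set \<Rightarrow> nat" where
  "scenario_size C \<P> = card C + (\<Sum>p\<in>\<P>. card (fst p))"

lemma cubeD:
  assumes "cube n K C \<P>"
  shows "finite \<P>" "C \<subseteq> {1..2 * n}" "finite C" "even (card C)"
proof -
  show "finite \<P>" "C \<subseteq> {1..2 * n}" "even (card C)"
    using assms by (simp_all add: cube_def)
  then show "finite C" using finite_subset[OF _ finite_atLeastAtMost] by blast
qed

lemma cube_pairD:
  assumes "cube n K C \<P>" "p \<in> \<P>"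
  shows "fst p \<subseteq> {1..2 * n}" "snd p \<subseteq> {1..2 * n}" "finite (fst p)" "finite (snd p)"
    "fst p \<inter> snd p = {}" "card (snd p) = card (fst p)" "even (card (fst p))" "fst p \<noteq> {}"
    "card (fst p) \<le> 2 * K" "C \<inter> (fst p \<union> snd p) = {}"
proof -
  have *: "\<forall>p\<in>\<P>. fst p \<subseteq> {1..2 * n} \<and> snd p \<subseteq> {1..2 * n} \<and> fst p \<inter> snd p = {} \<and>
        card (snd p) = card (fst p) \<and> even (card (fst p)) \<and> fst p \<noteq> {} \<and>
        card (fst p) \<le> 2 * K \<and> C \<inter> (fst p \<union> snd p) = {}"
    using assms(1) unfolding cube_def by (elim conjE)
  show sub: "fst p \<subseteq> {1..2 * n}" "snd p \<subseteq> {1..2 * n}"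
    and "fst p \<inter> snd p = {}" "card (snd p) = card (fst p)" "even (card (fst p))" "fst p \<noteq> {}"
    "card (fst p) \<le> 2 * K" "C \<inter> (fst p \<union> snd p) = {}"
    using bspec[OF * assms(2)] by simp_all
  show "finite (fst p)" "finite (snd p)"
    using finite_subset[OF sub(1)] finite_subset[OF sub(2)] by simp_all
qed

lemma cube_disjointD:
  assumes "cube n K C \<P>" "p \<in> \<P>" "q \<in> \<P>" "p \<noteq> q"
  shows "(fst p \<union> snd p) \<inter> (fst q \<union> snd q) = {}"
  using assms unfolding cube_def by simp

lemma cube_touched_subset: "cube n K C \<P> \<Longrightarrow> touched C \<P> \<subseteq> {1..2 * n}"
  unfolding touched_def using cubeD(2) cube_pairD(1,2) by (intro Un_least UN_least)

lemma card_touched: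
  assumes "cube n K C \<P>"
  shows "card (touched C \<P>) = scenario_size C \<P> + (\<Sum>p\<in>\<P>. card (fst p))"
proof -
  note fin = cubeD(1)[OF assms] cube_pairD(3,4)[OF assms]
  have "card (\<Union>p\<in>\<P>. fst p \<union> snd p) = (\<Sum>p\<in>\<P>. card (fst p \<union> snd p))"
    using fin cube_disjointD[OF assms] by (intro card_UN_disjoint) simp_all
  also have "\<dots> = (\<Sum>p\<in>\<P>. card (fst p) + card (fst p))"
    using fin cube_pairD(5,6)[OF assms] by (intro sum.cong refl) (simp add: card_Un_disjoint)
  finally have "card (\<Union>p\<in>\<P>. fst p \<union> snd p) = (\<Sum>p\<in>\<P>. card (fst p) + card (fst p))" .
  moreover have "card (touched C \<P>) = card C + card (\<Union>p\<in>\<P>. fst p \<union> snd p)"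
    unfolding touched_def using fin cubeD(3)[OF assms] cube_pairD(10)[OF assms]
    by (intro card_Un_disjoint) (auto simp: Int_UN_distrib)
  ultimately show ?thesis by (simp add: scenario_size_def sum.distrib)
qed

lemma even_card_touched:
  assumes "cube n K C \<P>"
  shows "even (card (touched C \<P>))"
  unfolding card_touched[OF assms] using cubeD(4)[OF assms] by (simp add: scenario_size_def)

lemma cube_extend:
  assumes "cube n K C \<P>" "S \<subseteq> {1..2 * n} - touched C \<P>" "even (card S)"
  shows "cube n K (C \<union> S) \<P>" "scenario_size (C \<union> S) \<P> = scenario_size C \<P> + card S"
proof -
  have fin: "finite C" "finite S"
    using cubeD(3)[OF assms(1)] finite_subset[OF assms(2)] by simp_all
  have disj: "C \<inter> S = {}" "\<forall>p\<in>\<P>. S \<inter> (fst p \<union> snd p) = {}"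
    using assms(2) unfolding touched_def by blast+
  have card: "card (C \<union> S) = card C + card S"
    using fin disj by (simp add: card_Un_disjoint)
  have "even (card C)" "C \<subseteq> {1..2 * n}" "S \<subseteq> {1..2 * n}"
    using cubeD[OF assms(1)] assms(2) by blast+
  then have "even (card (C \<union> S))" "C \<union> S \<subseteq> {1..2 * n}"
    using assms(3) card by auto
  then show "cube n K (C \<union> S) \<P>"
    using assms(1) disj unfolding cube_def by (simp add: Int_Un_distrib2)
  show "scenario_size (C \<union> S) \<P> = scenario_size C \<P> + card S"
    by (simp add: scenario_size_def card)
qed

lemma cube_resolve:
  assumes "cube n K C \<P>" "p \<in> \<P>" "E = fst p \<or> E = snd p"
  shows "cube n K (C \<union> E) (\<P> - {p})" "scenario_size (C \<union> E) (\<P> - {p}) = scenario_size C \<P>"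
proof -
  have E: "E \<subseteq> {1..2 * n}" "card E = card (fst p)" "even (card E)" "C \<inter> E = {}"
    using cube_pairD[OF assms(1,2)] assms(3) by auto
  have fin: "finite C" "finite E"
    using cubeD(3)[OF assms(1)] finite_subset[OF E(1)] by simp_all
  have card: "card (C \<union> E) = card C + card (fst p)"
    using fin E by (simp add: card_Un_disjoint)
  have disj: "\<forall>q\<in>\<P> - {p}. E \<inter> (fst q \<union> snd q) = {}"
    using cube_disjointD[OF assms(1,2)] assms(3) by fast
  have "even (card C)" "C \<subseteq> {1..2 * n}"
    using cubeD[OF assms(1)] by blast+
  then have "even (card (C \<union> E))" "C \<union> E \<subseteq> {1..2 * n}"
    using E card by auto
  then show "cube n K (C \<union> E) (\<P> - {p})"
    using assms(1) disj unfolding cube_def by (simp add: Int_Un_distrib2)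
  show "scenario_size (C \<union> E) (\<P> - {p}) = scenario_size C \<P>"
    using assms(2) cubeD(1)[OF assms(1)] by (simp add: scenario_size_def card sum.remove)
qed

text \<open>If the past continues with \<open>S\<close> or with \<open>S'\<close>, the intersection
  is certain and the two differences form a new pair. An even intersection makes both differences
  even.\<close>

lemma cube_insert:
  assumes "cube n K C \<P>" "S \<noteq> S'" "card S = 2 * K" "card S' = 2 * K"
    and "S \<subseteq> {1..2 * n} - touched C \<P>" "S' \<subseteq> {1..2 * n} - touched C \<P>" "even (card (S \<inter> S'))"
  shows "cube n K (C \<union> (S \<inter> S')) (insert (S - S', S' - S) \<P>)" "(S - S', S' - S) \<notin> \<P>"
    "scenario_size (C \<union> (S \<inter> S')) (insert (S - S', S' - S) \<P>) = scenario_size C \<P> + 2 * K"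
proof -
  have fin: "finite S" "finite S'" "finite \<P>"
    using cubeD(1)[OF assms(1)] finite_subset[OF assms(5)] finite_subset[OF assms(6)] by simp_all
  have card: "card (S - S') + card (S \<inter> S') = 2 * K" "card (S' - S) + card (S \<inter> S') = 2 * K"
    using card_Diff_subset_Int[of S S'] card_Diff_subset_Int[of S' S] fin assms(3,4)
      card_mono[OF fin(1), of "S \<inter> S'"] card_mono[OF fin(2), of "S \<inter> S'"]
    by (simp_all add: Int_commute)
  have ne: "S - S' \<noteq> {}"
    using assms(2,3,4) card_subset_eq[OF fin(2), of S] by auto
  have base: "cube n K (C \<union> (S \<inter> S')) \<P>"
      "scenario_size (C \<union> (S \<inter> S')) \<P> = scenario_size C \<P> + card (S \<inter> S')"
    using assms(5,6,7) by (intro cube_extend[OF assms(1)]; auto)+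
  have disj: "\<forall>q\<in>\<P>. (S \<union> S') \<inter> (fst q \<union> snd q) = {}" "C \<inter> (S \<union> S') = {}"
    using assms(5,6) unfolding touched_def by blast+
  show new: "(S - S', S' - S) \<notin> \<P>"
    using disj(1) ne by fastforce
  have "even (card (S - S'))" using card(1) assms(7) by (metis even_add even_mult_iff even_numeral)
  moreover have "card (S' - S) = card (S - S')" "card (S - S') \<le> 2 * K" using card by linarith+
  moreover have "S - S' \<subseteq> {1..2 * n}" "S' - S \<subseteq> {1..2 * n}" using assms(5,6) by blast+
  moreover have "(C \<union> (S \<inter> S')) \<inter> ((S - S') \<union> (S' - S)) = {}" using disj(2) by blast
  moreover have "\<forall>q\<in>\<P>. ((S - S') \<union> (S' - S)) \<inter> (fst q \<union> snd q) = {}"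
      "\<forall>q\<in>\<P>. (fst q \<union> snd q) \<inter> ((S - S') \<union> (S' - S)) = {}"
    using disj(1) by blast+
  moreover have "(S - S') \<inter> (S' - S) = {}" by blast
  ultimately show "cube n K (C \<union> (S \<inter> S')) (insert (S - S', S' - S) \<P>)"
    using base(1) ne unfolding cube_def by simp
  show "scenario_size (C \<union> (S \<inter> S')) (insert (S - S', S' - S) \<P>) = scenario_size C \<P> + 2 * K"
    using base(2) new fin card by (simp add: scenario_size_def)
qed

section \<open>Total loss over a cube and the endgame\<close>

locale open_book =
  fixes n m :: nat and A :: alice_strategy
  assumes valid: "valid_alice n m A"
begin

lemma next_move_range: "length x = m \<Longrightarrow> next_move A x rs \<in> {1..2 * n}"
  using valid by (simp add: valid_alice_def)

lemma length_transition:
  "y \<in> {1..2 * n} \<Longrightarrow> length x = m \<Longrightarrow> length (transition A y x t rs) = m"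
  using valid by (simp add: valid_alice_def)

lemma n_pos: "n > 0"
  using next_move_range[of "replicate m False" "[]"] by (cases n) auto

text \<open>The terms share Alice's state and coins, but each uses Bob's optimum for its own
  scenario. The sum is not normalised, so scenarios in which Alice loses simply drop out.\<close>

definition loss :: "nat \<Rightarrow> nat set \<Rightarrow> (nat set \<times> nat set) set \<Rightarrow> bool list \<Rightarrow> bool list list \<Rightarrow> real" where
  "loss k C \<P> x rs = (\<Sum>T\<in>Pow \<P>. 1 - win_prob n A k x (scenario C \<P> T) rs)"

lemma loss_le:
  assumes "finite \<P>"
  shows "loss k C \<P> x rs \<le> 2 ^ card \<P>"
proof -
  have "loss k C \<P> x rs \<le> (\<Sum>T\<in>Pow \<P>. 1)"
    unfolding loss_def using win_prob_bounds[OF n_pos] by (intro sum_mono) (simp add: diff_le_eq)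
  then show ?thesis using assms by (simp add: card_Pow)
qed

text \<open>A choice of pairs contains \<open>p\<close> or not, which makes one component of
  \<open>p\<close> certain.\<close>

lemma loss_insert:
  assumes "finite \<P>" "p \<notin> \<P>"
  shows "loss k C (insert p \<P>) x rs = loss k (C \<union> fst p) \<P> x rs + loss k (C \<union> snd p) \<P> x rs"
proof -
  have out: "scenario C (insert p \<P>) T = scenario (C \<union> snd p) \<P> T" if "T \<in> Pow \<P>" for T
    using that assms(2) unfolding scenario_def by auto
  have "(\<Union>q\<in>\<P>. if q \<in> insert p T then fst q else snd q) = (\<Union>q\<in>\<P>. if q \<in> T then fst q else snd q)" for T
    using assms(2) by (intro SUP_cong) auto
  then have into: "scenario C (insert p \<P>) (insert p T) = scenario (C \<union> fst p) \<P> T" for T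
    by (simp only: scenario_def UN_insert insertI1 if_True Un_assoc)
  have inj: "inj_on (insert p) (Pow \<P>)"
    using assms(2) by (intro inj_onI) (metis PowD insert_ident subsetD)
  have "loss k C (insert p \<P>) x rs =
      (\<Sum>T\<in>Pow \<P>. 1 - win_prob n A k x (scenario C (insert p \<P>) T) rs) +
      (\<Sum>T\<in>insert p ` Pow \<P>. 1 - win_prob n A k x (scenario C (insert p \<P>) T) rs)"
    unfolding loss_def Pow_insert using assms by (intro sum.union_disjoint) auto
  then show ?thesis
    by (simp add: loss_def sum.reindex[OF inj] out into)
qed

lemma loss_repeat: "next_move A x rs \<in> C \<Longrightarrow> loss (Suc k) C \<P> x rs = 0"
  by (simp add: loss_def scenario_def)

text \<open>Bob's optimum is at least as good as the reply \<open>y\<close>, which is legal in every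
  scenario. The same reply in all of them leads Alice to one common state, so the scenarios stay
  confused.\<close>

lemma loss_step:
  assumes "next_move A x rs \<notin> touched C \<P>" "y \<notin> insert (next_move A x rs) (touched C \<P>)"
    and "y \<in> {1..2 * n}"
  shows "loss (Suc k) C \<P> x rs \<le> avg (strings A (Suc (length rs)))
    (\<lambda>r. loss k (C \<union> {next_move A x rs, y}) \<P>
      (transition A y x (2 * Suc (length rs)) (rs @ [r])) (rs @ [r]))"
proof -
  let ?a = "next_move A x rs"
  let ?x = "\<lambda>r. transition A y x (2 * Suc (length rs)) (rs @ [r])"
  let ?w = "\<lambda>T r. win_prob n A k (?x r) (scenario (C \<union> {?a, y}) \<P> T) (rs @ [r])"
  have "avg (strings A (Suc (length rs))) (?w T) \<le> win_prob n A (Suc k) x (scenario C \<P> T) rs" for T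
  proof -
    have sub: "scenario C \<P> T \<subseteq> touched C \<P>"
      unfolding scenario_def touched_def by auto
    have eq: "scenario (C \<union> {?a, y}) \<P> T = scenario C \<P> T \<union> {?a, y}"
      unfolding scenario_def by blast
    have "avg (strings A (Suc (length rs))) (?w T)
        = reply_value A (win_prob n A k) x (scenario C \<P> T) rs y"
      using assms(2) sub unfolding reply_value_def eq Let_def by auto
    also have "\<dots> \<le> Max (reply_value A (win_prob n A k) x (scenario C \<P> T) rs ` {1..2 * n})"
      using assms(3) by (intro Max_ge) auto
    finally show ?thesis using assms(1) sub by auto
  qed
  then have "loss (Suc k) C \<P> x rs \<le> (\<Sum>T\<in>Pow \<P>. 1 - avg (strings A (Suc (length rs))) (?w T))"
    unfolding loss_def by (intro sum_mono diff_left_mono)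
  then show ?thesis
    unfolding loss_def avg_sum by (simp add: avg_diff_const)
qed

text \<open>
  When Alice names a number of an ambiguous pair, she loses in half of the scenarios; in the
  others Bob replies inside the same component, which keeps the number of untouched numbers even.
\<close>

lemma loss_resolve:
  assumes "cube n K C \<P>" "length x = m" "next_move A x rs \<in> touched C \<P>"
    and "loss (Suc k) C \<P> x rs \<noteq> 0"
  obtains p C' y where "p \<in> \<P>" "cube n K C' (\<P> - {p})"
    "scenario_size C' (\<P> - {p}) = scenario_size C \<P> + 2" "y \<in> {1..2 * n}"
    "loss (Suc k) C \<P> x rs \<le> avg (strings A (Suc (length rs)))
      (\<lambda>r. loss k C' (\<P> - {p}) (transition A y x (2 * Suc (length rs)) (rs @ [r])) (rs @ [r]))"
proof -
  let ?a = "next_move A x rs"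
  have "?a \<notin> C" using loss_repeat assms(4) by blast
  then obtain p where "p \<in> \<P>" "?a \<in> fst p \<union> snd p"
    using assms(3) unfolding touched_def by auto
  then obtain D E where p: "p \<in> \<P>" "?a \<in> D" "D = fst p \<and> E = snd p \<or> D = snd p \<and> E = fst p"
    by blast
  have fin: "finite \<P>" "finite D"
    using cubeD(1)[OF assms(1)] cube_pairD(3,4)[OF assms(1) p(1)] p(3) by auto
  have D: "D \<subseteq> {1..2 * n}" "even (card D)" "D \<inter> E = {}" "C \<inter> D = {}"
    using cube_pairD[OF assms(1) p(1)] p(3) by auto
  have D': "\<forall>q\<in>\<P> - {p}. D \<inter> (fst q \<union> snd q) = {}"
    using cube_disjointD[OF assms(1) p(1)] p(3) by fast
  have "insert p (\<P> - {p}) = \<P>" using p(1) by blast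
  then have "loss (Suc k) C \<P> x rs
      = loss (Suc k) (C \<union> fst p) (\<P> - {p}) x rs + loss (Suc k) (C \<union> snd p) (\<P> - {p}) x rs"
    using loss_insert[of "\<P> - {p}" p "Suc k" C x rs] fin(1) by simp
  also have "\<dots> = loss (Suc k) (C \<union> D) (\<P> - {p}) x rs + loss (Suc k) (C \<union> E) (\<P> - {p}) x rs"
    using p(3) by auto
  also have "\<dots> = loss (Suc k) (C \<union> E) (\<P> - {p}) x rs"
    using p(2) by (simp add: loss_repeat)
  finally have loss: "loss (Suc k) C \<P> x rs = loss (Suc k) (C \<union> E) (\<P> - {p}) x rs" .
  \<comment> \<open>The component \<open>D\<close> has even size, so Bob finds a second number in
    it.\<close>
  have "D \<noteq> {?a}" using D(2) by auto
  then obtain y where y: "y \<in> D" "y \<noteq> ?a" using p(2) by blast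
  have E: "E = fst p \<or> E = snd p" using p(3) by auto
  note res = cube_resolve[OF assms(1) p(1) E]
  \<comment> \<open>In the surviving scenarios \<open>E\<close> was named and \<open>D\<close> was
    not, so both \<open>?a\<close> and \<open>y\<close> are fresh.\<close>
  have out: "D \<inter> touched (C \<union> E) (\<P> - {p}) = {}"
    using D(3,4) D' unfolding touched_def by auto
  have ay: "card {?a, y} = 2" "{?a, y} \<subseteq> {1..2 * n} - touched (C \<union> E) (\<P> - {p})"
    using y p(2) D(1) out by auto
  then have new: "cube n K (C \<union> E \<union> {?a, y}) (\<P> - {p})"
      "scenario_size (C \<union> E \<union> {?a, y}) (\<P> - {p}) = scenario_size C \<P> + 2"
    using cube_extend[OF res(1) ay(2)] res(2) by simp_all
  have "loss (Suc k) C \<P> x rs \<le> avg (strings A (Suc (length rs)))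
      (\<lambda>r. loss k (C \<union> E \<union> {?a, y}) (\<P> - {p}) (transition A y x (2 * Suc (length rs)) (rs @ [r])) (rs @ [r]))"
    unfolding loss using out p(2) y D(1) by (intro loss_step) auto
  with p(1) new show thesis using that y(1) D(1) by blast
qed

text \<open>Bob never has to move first inside a pair: after a fresh move of Alice parity leaves him
  another untouched number, and a move inside a pair resolves it. At the end at most one scenario
  survives, so all \<open>2 ^ card \<P>\<close> scenarios together have loss at most 1.\<close>

lemma endgame:
  assumes "cube n K C \<P>" "length x = m" "k \<le> n" "scenario_size C \<P> = 2 * (n - k)"
  shows "loss k C \<P> x rs \<le> 1"
  using assms
proof (induction k arbitrary: C \<P> x rs)
  case 0
  have "card (touched C \<P>) \<le> 2 * n"
    using card_mono[OF _ cube_touched_subset[OF 0(1)]] by simp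
  \<comment> \<open>Each scenario already contains all \<open>2 * n\<close> numbers, which leaves no
    room for a pair.\<close>
  then have "(\<Sum>p\<in>\<P>. card (fst p)) = 0"
    using card_touched[OF 0(1)] 0(4) by simp
  then have "\<P> = {}"
    using cubeD(1)[OF 0(1)] cube_pairD(3,8)[OF 0(1)] by fastforce
  then show ?case using loss_le[of "{}"] by simp
next
  case (Suc k)
  let ?a = "next_move A x rs"
  have bound: "avg (strings A (Suc (length rs)))
      (\<lambda>r. loss k C' \<P>' (transition A y x (2 * Suc (length rs)) (rs @ [r])) (rs @ [r])) \<le> 1"
    if "cube n K C' \<P>'" "scenario_size C' \<P>' = scenario_size C \<P> + 2" "y \<in> {1..2 * n}" for C' \<P>' y
    using that Suc.prems length_transition by (intro avg_le Suc.IH) auto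
  consider "loss (Suc k) C \<P> x rs = 0" | "?a \<notin> touched C \<P>"
    | "loss (Suc k) C \<P> x rs \<noteq> 0" "?a \<in> touched C \<P>" by blast
  then show ?case
  proof cases
    case 1
    then show ?thesis by simp
  next
    case 2
    have a: "?a \<in> {1..2 * n}" using next_move_range Suc.prems(2) .
    have fin: "finite (touched C \<P>)"
      using cube_touched_subset[OF Suc.prems(1)] finite_subset[OF _ finite_atLeastAtMost] by blast
    have "insert ?a (touched C \<P>) \<subseteq> {1..2 * n}"
      using a cube_touched_subset[OF Suc.prems(1)] by blast
    moreover have "card (insert ?a (touched C \<P>)) \<noteq> card {1..2 * n}"
    proof -
      have "odd (card (insert ?a (touched C \<P>)))"
        using 2 fin even_card_touched[OF Suc.prems(1)] by simp
      then show ?thesis by (metis card_atLeastAtMost diff_Suc_1 even_mult_iff even_numeral)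
    qed
    ultimately have "insert ?a (touched C \<P>) \<subset> {1..2 * n}"
      by (metis psubsetI)
    then obtain y where y: "y \<in> {1..2 * n}" "y \<notin> insert ?a (touched C \<P>)" by blast
    have ay: "card {?a, y} = 2" "{?a, y} \<subseteq> {1..2 * n} - touched C \<P>"
      using y a 2 by auto
    then have "cube n K (C \<union> {?a, y}) \<P>"
        "scenario_size (C \<union> {?a, y}) \<P> = scenario_size C \<P> + 2"
      using cube_extend[OF Suc.prems(1) ay(2)] by simp_all
    from bound[OF this y(1)] loss_step[OF 2 y(2,1)] show ?thesis by (rule order_trans[rotated])
  next
    case 3
    from loss_resolve[OF Suc.prems(1,2) 3(2,1)] obtain p C' y where
      "cube n K C' (\<P> - {p})" "scenario_size C' (\<P> - {p}) = scenario_size C \<P> + 2"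
      "y \<in> {1..2 * n}" and le: "loss (Suc k) C \<P> x rs \<le> avg (strings A (Suc (length rs)))
        (\<lambda>r. loss k C' (\<P> - {p}) (transition A y x (2 * Suc (length rs)) (rs @ [r])) (rs @ [r]))"
      by blast
    from bound[OF this(1-3)] le show ?thesis by (rule order_trans[rotated])
  qed
qed

end

section \<open>Creating ambiguity in phases\<close>

lemma touched_Un: "touched (C \<union> S) \<P> = touched C \<P> \<union> S"
  unfolding touched_def by blast

locale open_book_phases = open_book +
  fixes H K :: nat
  assumes n_eq: "n = 4 * H * K"
begin

lemma HK_pos: "H > 0" "K > 0"
  using n_pos n_eq by (auto intro: Nat.gr0I)

text \<open>
  Distinct pasts are abundant: a phase offers at least \<open>n ^ K\<close> sequences of replies, a set of
  \<open>2 K\<close> numbers arises from at most \<open>(2 K) ^ K\<close> of them, and the quotient is \<open>(2 H) ^ K\<close>.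
\<close>

definition err :: real where
  "err = 2 ^ m * (2 * real n + 1) / (2 * real H) ^ K"

text \<open>The factor \<open>2 ^ p\<close> counts scenarios. Of \<open>H\<close> pairs wanted,
  \<open>h\<close> are spent, and the others leave failure probability
  \<open>(1 / 2) ^ (H - h)\<close>. The term \<open>err * real k\<close> allows one failed phase per
  remaining round, since a phase lasts at least one round.\<close>

definition loss_bound :: "nat \<Rightarrow> nat \<Rightarrow> nat \<Rightarrow> real" where
  "loss_bound k p h = 2 ^ p * ((1 / 2) ^ (H - h) + err * real k)"

lemma err_nonneg: "0 \<le> err"
  by (simp add: err_def)

lemma loss_bound_nonneg: "0 \<le> loss_bound k p h"
  by (simp add: loss_bound_def err_nonneg)

lemma loss_bound_mono: "k \<le> k' \<Longrightarrow> loss_bound k p h \<le> loss_bound k' p h"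
  unfolding loss_bound_def using err_nonneg by (intro mult_left_mono add_left_mono) auto

lemma loss_bound_Suc: "loss_bound k (Suc p) h = 2 * loss_bound k p h"
  by (simp add: loss_bound_def)

text \<open>Resolving a pair halves the number of scenarios, which exactly offsets the factor 2
  gained from raising \<open>h\<close>; the error term only shrinks.\<close>

lemma loss_bound_hit:
  assumes "h < H"
  shows "loss_bound k p (Suc h) \<le> loss_bound k (Suc p) h"
proof -
  obtain d where "H - h = Suc d" "H - Suc h = d"
    using assms by (metis Suc_diff_Suc)
  then show ?thesis
    using err_nonneg by (simp add: loss_bound_def algebra_simps)
qed

text \<open>
  Two sets of loss above \<open>B\<close> cannot have an even intersection, since they would form a further
  ambiguous pair, for which the average loss is at most \<open>B\<close>.
\<close>

lemma card_heavy:
  assumes "cube n K C \<P>"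
    and pair: "\<And>C' \<P>'. cube n K C' \<P>' \<Longrightarrow> card \<P>' = Suc (card \<P>) \<Longrightarrow>
      scenario_size C' \<P>' = scenario_size C \<P> + 2 * K \<Longrightarrow> loss k C' \<P>' x rs \<le> 2 * B"
  defines "\<H> \<equiv> {S. S \<subseteq> {1..2 * n} - touched C \<P> \<and> card S = 2 * K \<and> loss k (C \<union> S) \<P> x rs > B}"
  shows "finite \<H> \<and> card \<H> \<le> 2 * n + 1"
proof -
  have "odd (card (S \<inter> S'))" if "S \<in> \<H>" "S' \<in> \<H>" "S \<noteq> S'" for S S'
  proof
    assume ev: "even (card (S \<inter> S'))"
    let ?C = "C \<union> (S \<inter> S')" and ?p = "(S - S', S' - S)"
    note new = cube_insert[of n K C \<P> S S', OF assms(1) that(3) _ _ _ _ ev]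
    have S: "S \<subseteq> {1..2 * n} - touched C \<P>" "S' \<subseteq> {1..2 * n} - touched C \<P>"
        "card S = 2 * K" "card S' = 2 * K"
        "loss k (C \<union> S) \<P> x rs > B" "loss k (C \<union> S') \<P> x rs > B"
      using that by (simp_all add: \<H>_def)
    have fin: "finite \<P>" using cubeD(1)[OF assms(1)] .
    have "loss k ?C (insert ?p \<P>) x rs \<le> 2 * B"
      using new S fin by (intro pair) simp_all
    moreover have "?C \<union> fst ?p = C \<union> S" "?C \<union> snd ?p = C \<union> S'" by auto
    then have "loss k ?C (insert ?p \<P>) x rs = loss k (C \<union> S) \<P> x rs + loss k (C \<union> S') \<P> x rs"
      using loss_insert[of \<P> ?p k ?C x rs] new(2) S fin by simp
    ultimately show False using S by linarith
  qed
  then have "finite \<H> \<and> card \<H> \<le> Suc (card {1..2 * n})"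
    by (intro even_odd_town) (auto simp: \<H>_def)
  then show ?thesis by simp
qed

text \<open>
  The moves \<open>ys\<close> of Bob during a phase index the pasts under consideration. Averaging over \<open>ys\<close>
  for fixed coins of Alice replaces a random strategy of Bob.
\<close>

lemma phase_end:
  fixes X :: "nat list \<Rightarrow> bool list"
  assumes "cube n K C \<P>" "finite Y" "0 \<le> B"
    and Y: "\<And>ys. ys \<in> Y \<Longrightarrow> length (X ys) = m \<and> length ys = K \<and> set ys \<subseteq> S ys \<and>
      S ys \<subseteq> {1..2 * n} - touched C \<P> \<and> card (S ys) = 2 * K"
    and pair: "\<And>C' \<P>' x. cube n K C' \<P>' \<Longrightarrow> card \<P>' = Suc (card \<P>) \<Longrightarrow>
      scenario_size C' \<P>' = scenario_size C \<P> + 2 * K \<Longrightarrow> length x = m \<Longrightarrow> loss k C' \<P>' x rs \<le> 2 * B"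
  shows "(\<Sum>ys\<in>Y. loss k (C \<union> S ys) \<P> (X ys) rs)
    \<le> real (card Y) * B + 2 ^ card \<P> * (2 ^ m * (2 * real n + 1) * (2 * real K) ^ K)"
proof -
  define \<H> where "\<H> = (\<lambda>x. {S. S \<subseteq> {1..2 * n} - touched C \<P> \<and> card S = 2 * K \<and>
    loss k (C \<union> S) \<P> x rs > B})"
  have heavy: "finite (\<H> x) \<and> card (\<H> x) \<le> 2 * n + 1" if "length x = m" for x
    unfolding \<H>_def using pair that by (intro card_heavy assms(1)) auto
  \<comment> \<open>Each index in \<open>Z\<close> is a sequence over a heavy set of
    \<open>2 * K\<close> numbers. There are \<open>2 ^ m\<close> memory states and at most
    \<open>2 * n + 1\<close> heavy sets for each; these exceptional indices get the trivial bound on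
    the loss.\<close>
  define Z where "Z = {ys \<in> Y. S ys \<in> \<H> (X ys)}"
  define M where "M = {x :: bool list. length x = m}"
  define L where "L = (\<lambda>S :: nat set. {ys. set ys \<subseteq> S \<and> length ys = K})"
  have M: "finite M" "card M = 2 ^ m"
    unfolding M_def using finite_lists_length_eq[of "UNIV :: bool set" m]
      card_lists_length_eq[of "UNIV :: bool set" m] by simp_all
  have finS: "finite T" if "T \<in> \<H> x" for T x
    using that finite_subset[of T "{1..2 * n} - touched C \<P>"] by (auto simp: \<H>_def)
  have L: "finite (L T)" "card (L T) = (2 * K) ^ K" if "T \<in> \<H> x" for T x
    unfolding L_def using finite_lists_length_eq[OF finS[OF that], of K]
      card_lists_length_eq[OF finS[OF that], of K] that by (simp_all add: \<H>_def)
  have "card (\<Union>T\<in>\<H> x. L T) \<le> (2 * n + 1) * (2 * K) ^ K" if "x \<in> M" for x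
  proof -
    have "card (\<Union>T\<in>\<H> x. L T) \<le> (\<Sum>T\<in>\<H> x. card (L T))"
      using heavy that by (intro card_UN_le) (simp add: M_def)
    also have "\<dots> = card (\<H> x) * (2 * K) ^ K" using L by simp
    also have "\<dots> \<le> (2 * n + 1) * (2 * K) ^ K"
      using heavy that by (intro mult_right_mono) (simp_all add: M_def)
    finally show ?thesis .
  qed
  then have "card (\<Union>x\<in>M. \<Union>T\<in>\<H> x. L T) \<le> (\<Sum>x\<in>M. (2 * n + 1) * (2 * K) ^ K)"
    by (intro order_trans[OF card_UN_le[OF M(1)]] sum_mono)
  moreover have "Z \<subseteq> (\<Union>x\<in>M. \<Union>T\<in>\<H> x. L T)"
    using Y unfolding Z_def M_def L_def by blast
  moreover have "finite (\<Union>x\<in>M. \<Union>T\<in>\<H> x. L T)"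
    using M heavy L by (intro finite_UN_I) (auto simp: M_def)
  ultimately have "card Z \<le> 2 ^ m * ((2 * n + 1) * (2 * K) ^ K)"
    using card_mono[of "\<Union>x\<in>M. \<Union>T\<in>\<H> x. L T" Z] M by simp
  then have "real (card Z) \<le> real (2 ^ m * ((2 * n + 1) * (2 * K) ^ K))"
    by (rule of_nat_mono)
  then have Z: "real (card Z) \<le> 2 ^ m * (2 * real n + 1) * (2 * real K) ^ K"
    by (simp add: algebra_simps)
  have "(\<Sum>ys\<in>Y. loss k (C \<union> S ys) \<P> (X ys) rs)
      \<le> (\<Sum>ys\<in>Y. B + (if ys \<in> Z then 2 ^ card \<P> else 0))"
  proof (rule sum_mono)
    fix ys assume "ys \<in> Y"
    then show "loss k (C \<union> S ys) \<P> (X ys) rs \<le> B + (if ys \<in> Z then 2 ^ card \<P> else 0)"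
      using Y loss_le[OF cubeD(1)[OF assms(1)], of k "C \<union> S ys" "X ys" rs] assms(3)
      by (auto simp: Z_def \<H>_def)
  qed
  also have "\<dots> = real (card Y) * B + 2 ^ card \<P> * real (card Z)"
  proof -
    have "Y \<inter> {ys. ys \<in> Z} = Z" by (auto simp: Z_def)
    then show ?thesis using assms(2) by (simp add: sum.distrib sum.If_cases)
  qed
  also have "\<dots> \<le> real (card Y) * B + 2 ^ card \<P> * (2 ^ m * (2 * real n + 1) * (2 * real K) ^ K)"
    using Z by (intro add_left_mono mult_left_mono) auto
  finally show ?thesis .
qed

text \<open>
  Once Alice touches an ambiguous pair, the phase is abandoned and a new one starts. In
  \<open>loss_bound k p h\<close>, the number of pairs that were resolved so far is \<open>h\<close>.
\<close>

lemma phase: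
  fixes X :: "nat list \<Rightarrow> bool list"
  assumes IH: "\<And>k C \<P> h x rs. k < k0 \<Longrightarrow> cube n K C \<P> \<Longrightarrow> length x = m \<Longrightarrow>
      scenario_size C \<P> = 2 * (n - k) \<Longrightarrow> n - k \<le> K * (2 * h + card \<P>) \<Longrightarrow> h + card \<P> \<le> H \<Longrightarrow>
      loss k C \<P> x rs \<le> loss_bound k (card \<P>) h"
    and k0: "k0 \<le> n" "n - k0 \<le> K * (2 * h + card \<P>)" "h + card \<P> < H" "K \<le> k0"
    and C: "cube n K C \<P>" "scenario_size C \<P> = 2 * (n - k0)"
    and "t + d = K" "finite Y"
    and "\<And>ys. ys \<in> Y \<Longrightarrow> length (X ys) = m \<and> length ys = t \<and> set ys \<subseteq> S ys \<and>
      S ys \<subseteq> {1..2 * n} - touched C \<P> \<and> card (S ys) = 2 * t"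
  shows "(\<Sum>ys\<in>Y. loss (k0 - t) (C \<union> S ys) \<P> (X ys) rs)
    \<le> real (card Y) * loss_bound (k0 - 1) (card \<P>) h +
      2 ^ card \<P> * (2 ^ m * (2 * real n + 1) * (2 * real K) ^ K) / real n ^ d"
  using assms(8-)
proof (induction d arbitrary: t Y X S rs)
  case 0
  then have t: "t = K" by simp
  let ?B = "loss_bound (k0 - 1) (card \<P>) h"
  \<comment> \<open>A pair created in \<open>K\<close> rounds raises
    \<open>K * (2 * h + card \<P>)\<close> by \<open>K\<close>, so \<open>IH\<close> applies to the
    enlarged cube.\<close>
  have "loss (k0 - K) C' \<P>' x rs \<le> 2 * ?B"
    if "cube n K C' \<P>'" "card \<P>' = Suc (card \<P>)"
      "scenario_size C' \<P>' = scenario_size C \<P> + 2 * K" "length x = m" for C' \<P>' x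
  proof -
    have "loss (k0 - K) C' \<P>' x rs \<le> loss_bound (k0 - K) (card \<P>') h"
      using that k0 C(2) HK_pos by (intro IH) auto
    also have "\<dots> \<le> 2 * ?B"
      using loss_bound_mono[of "k0 - K" "k0 - 1" "Suc (card \<P>)" h] HK_pos that(2)
      by (simp add: loss_bound_Suc)
    finally show ?thesis .
  qed
  then have "(\<Sum>ys\<in>Y. loss (k0 - K) (C \<union> S ys) \<P> (X ys) rs)
      \<le> real (card Y) * ?B + 2 ^ card \<P> * (2 ^ m * (2 * real n + 1) * (2 * real K) ^ K)"
    using 0 t by (intro phase_end C(1) loss_bound_nonneg) auto
  then show ?case using t by simp
next
  case (Suc d)
  let ?B = "loss_bound (k0 - 1) (card \<P>) h"
  let ?D = "2 ^ card \<P> * (2 ^ m * (2 * real n + 1) * (2 * real K) ^ K)"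
  let ?R = "strings A (Suc (length rs))"
  define k where "k = k0 - Suc t"
  have k: "k0 - t = Suc k" "k < k0" "n - k = n - k0 + Suc t" "t < K"
    using Suc.prems(1) k0 by (auto simp: k_def)
  define a where "a = (\<lambda>ys. next_move A (X ys) rs)"
  define Y1 where "Y1 = {ys \<in> Y. a ys \<notin> touched C \<P> \<union> S ys}"
  define V where "V = (\<lambda>ys. {1..2 * n} - insert (a ys) (touched C \<P> \<union> S ys))"
  \<comment> \<open>The number of Bob's fresh replies, the same for every history in
    \<open>Y1\<close>.\<close>
  define q where "q = 2 * n - card (touched C \<P>) - 2 * t - 1"
  have fin1: "finite Y1" using Suc.prems(2) by (simp add: Y1_def)
  have finV: "finite (V ys)" for ys by (simp add: V_def)

  have ext: "cube n K (C \<union> S ys) \<P>" "scenario_size (C \<union> S ys) \<P> = 2 * (n - k0) + 2 * t"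
    if "ys \<in> Y" for ys
    using Suc.prems(3)[OF that] C(2) cube_extend[OF C(1), of "S ys"] by simp_all

  \<comment> \<open>Outside \<open>Y1\<close> Alice names a number that is certain, with loss 0, or
    one of a pair; in the latter case the phase is abandoned for a cube with one pair less.\<close>
  have hit: "loss (Suc k) (C \<union> S ys) \<P> (X ys) rs \<le> ?B" if "ys \<in> Y - Y1" for ys
  proof (cases "loss (Suc k) (C \<union> S ys) \<P> (X ys) rs = 0")
    case True
    then show ?thesis by (simp add: loss_bound_nonneg)
  next
    case False
    have ys: "ys \<in> Y" "length (X ys) = m" "next_move A (X ys) rs \<in> touched (C \<union> S ys) \<P>"
      using that Suc.prems(3) by (auto simp: Y1_def a_def touched_Un)
    obtain p C' y where p: "p \<in> \<P>"
      and C': "cube n K C' (\<P> - {p})"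
        "scenario_size C' (\<P> - {p}) = scenario_size (C \<union> S ys) \<P> + 2" "y \<in> {1..2 * n}"
      and le: "loss (Suc k) (C \<union> S ys) \<P> (X ys) rs \<le> avg ?R (\<lambda>r. loss k C' (\<P> - {p})
        (transition A y (X ys) (2 * Suc (length rs)) (rs @ [r])) (rs @ [r]))"
      by (rule loss_resolve[OF ext(1)[OF ys(1)] ys(2,3) False])
    have card: "card \<P> = Suc (card (\<P> - {p}))"
      by (rule card.remove[OF cubeD(1)[OF C(1)] p])
    note le
    also have "avg ?R (\<lambda>r. loss k C' (\<P> - {p})
        (transition A y (X ys) (2 * Suc (length rs)) (rs @ [r])) (rs @ [r]))
        \<le> loss_bound k (card (\<P> - {p})) (Suc h)"
    proof (intro avg_le finite_strings strings_nonempty IH)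
      \<comment> \<open>Trading a pair for a resolved one raises the right-hand side by
        \<open>2 * K - K\<close>, which covers the at most \<open>K\<close> rounds spent in this
        phase.\<close>
      show "n - k \<le> K * (2 * Suc h + card (\<P> - {p}))"
        using k(3,4) k0(2) unfolding card by (simp add: algebra_simps)
      show "scenario_size C' (\<P> - {p}) = 2 * (n - k)"
        using C'(2) ext(2)[OF ys(1)] k(3) by simp
      show "Suc h + card (\<P> - {p}) \<le> H"
        using k0(3) unfolding card by linarith
    qed (use k(2) C' ys length_transition in auto)
    also have "\<dots> \<le> loss_bound k (card \<P>) h"
      unfolding card using k0(3) by (intro loss_bound_hit) simp
    also have "\<dots> \<le> ?B" using k by (intro loss_bound_mono) simp
    finally show ?thesis .
  qed

  \<comment> \<open>A scenario has at most \<open>2 * K * (2 * h + card \<P>)\<close> numbers, and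
    the components not named add at most \<open>2 * K\<close> per pair. As
    \<open>n = 4 * H * K\<close> and \<open>h + card \<P> < H\<close>, at least \<open>n\<close>
    replies stay free throughout the phase.\<close>
  have small: "card (touched C \<P>) + 4 * K \<le> 4 * K * H"
  proof -
    have "(\<Sum>p\<in>\<P>. card (fst p)) \<le> (\<Sum>p\<in>\<P>. 2 * K)"
      using cube_pairD(9)[OF C(1)] by (intro sum_mono)
    then have "card (touched C \<P>) \<le> 2 * (K * (2 * h + card \<P>)) + card \<P> * (2 * K)"
      using card_touched[OF C(1)] C(2) k0(2) by simp
    also have "\<dots> = 4 * K * (h + card \<P>)" by (simp add: algebra_simps)
    finally have "card (touched C \<P>) + 4 * K \<le> 4 * K * (h + card \<P> + 1)" by simp
    also have "\<dots> \<le> 4 * K * H" using k0(3) by (intro mult_left_mono) auto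
    finally show ?thesis .
  qed
  then have q: "n \<le> q" using k(4) n_eq by (simp add: q_def algebra_simps)

  have cardV: "card (V ys) = q" if "ys \<in> Y1" for ys
  proof -
    have ys: "length (X ys) = m" "S ys \<subseteq> {1..2 * n} - touched C \<P>" "card (S ys) = 2 * t"
        "a ys \<notin> touched C \<P> \<union> S ys"
      using that Suc.prems(3) by (simp_all add: Y1_def)
    have sub: "insert (a ys) (touched C \<P> \<union> S ys) \<subseteq> {1..2 * n}"
      using ys next_move_range cube_touched_subset[OF C(1)] unfolding a_def by blast
    then have fin: "finite (touched C \<P>)" "finite (S ys)"
      using finite_subset[OF sub] by simp_all
    have "card (insert (a ys) (touched C \<P> \<union> S ys)) = Suc (card (touched C \<P>) + 2 * t)"
    proof -
      have "touched C \<P> \<inter> S ys = {}" using ys(2) by blast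
      then show ?thesis using fin ys(3,4) by (simp add: card_Un_disjoint)
    qed
    moreover have "card (V ys) = card {1..2 * n} - card (insert (a ys) (touched C \<P> \<union> S ys))"
      unfolding V_def using sub finite_subset[OF sub] by (intro card_Diff_subset) auto
    ultimately show ?thesis by (simp add: q_def)
  qed

  define Y2 where "Y2 = (\<lambda>(ys, y). ys @ [y]) ` (SIGMA ys:Y1. V ys)"
  define X2 where "X2 = (\<lambda>r zs. transition A (last zs) (X (butlast zs)) (2 * Suc (length rs)) (rs @ [r]))"
  define S2 where "S2 = (\<lambda>zs. S (butlast zs) \<union> {a (butlast zs), last zs})"
  have inj: "inj_on (\<lambda>(ys, y). ys @ [y]) (SIGMA ys:Y1. V ys)"
    by (auto simp: inj_on_def)
  have fin2: "finite Y2" unfolding Y2_def using fin1 finV by (intro finite_imageI finite_SigmaI)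
  have card2: "card Y2 = card Y1 * q"
    unfolding Y2_def card_image[OF inj] using fin1 finV cardV by (simp add: card_SigmaI)

  have Y2: "length (X2 r zs) = m \<and> length zs = Suc t \<and> set zs \<subseteq> S2 zs \<and>
      S2 zs \<subseteq> {1..2 * n} - touched C \<P> \<and> card (S2 zs) = 2 * Suc t" if "zs \<in> Y2" for zs r
  proof -
    obtain ys y where zs: "zs = ys @ [y]" "ys \<in> Y1" "y \<in> V ys"
      using \<open>zs \<in> Y2\<close> by (auto simp: Y2_def)
    have ys: "length (X ys) = m" "length ys = t" "set ys \<subseteq> S ys"
        "S ys \<subseteq> {1..2 * n} - touched C \<P>" "card (S ys) = 2 * t" "a ys \<notin> touched C \<P> \<union> S ys"
      using zs(2) Suc.prems(3) by (simp_all add: Y1_def)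
    have y: "y \<in> {1..2 * n}" "y \<noteq> a ys" "y \<notin> touched C \<P>" "y \<notin> S ys"
      using zs(3) by (simp_all add: V_def)
    have "finite (S ys)" using finite_subset[OF ys(4)] by simp
    then have "card (S ys \<union> {a ys, y}) = 2 * Suc t"
      using ys y by simp
    moreover have "a ys \<in> {1..2 * n}" using next_move_range[OF ys(1)] by (simp add: a_def)
    ultimately show ?thesis
      using ys y length_transition[OF y(1) ys(1)] by (auto simp: zs(1) X2_def S2_def)
  qed

  \<comment> \<open>Multiplying by \<open>q\<close> turns the average over Bob's replies into a sum
    over the extended histories.\<close>
  have "real q * (\<Sum>ys\<in>Y1. loss (Suc k) (C \<union> S ys) \<P> (X ys) rs)
      = (\<Sum>ys\<in>Y1. \<Sum>y\<in>V ys. loss (Suc k) (C \<union> S ys) \<P> (X ys) rs)"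
    by (simp add: sum_distrib_left cardV)
  also have "\<dots> \<le> (\<Sum>ys\<in>Y1. \<Sum>y\<in>V ys. avg ?R (\<lambda>r. loss k (C \<union> S2 (ys @ [y])) \<P> (X2 r (ys @ [y])) (rs @ [r])))"
  proof (intro sum_mono)
    fix ys y assume *: "ys \<in> Y1" "y \<in> V ys"
    show "loss (Suc k) (C \<union> S ys) \<P> (X ys) rs
        \<le> avg ?R (\<lambda>r. loss k (C \<union> S2 (ys @ [y])) \<P> (X2 r (ys @ [y])) (rs @ [r]))"
      using loss_step[of "X ys" rs "C \<union> S ys" \<P> y k] *
      by (simp add: Y1_def V_def a_def S2_def X2_def touched_Un Un_assoc)
  qed
  also have "\<dots> = (\<Sum>zs\<in>Y2. avg ?R (\<lambda>r. loss k (C \<union> S2 zs) \<P> (X2 r zs) (rs @ [r])))"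
    unfolding Y2_def sum.reindex[OF inj] using fin1 finV
    by (subst sum.Sigma) (auto simp: case_prod_unfold intro!: sum.cong)
  \<comment> \<open>With the average over coins outside, the induction hypothesis applies to each
    \<open>r\<close> separately.\<close>
  also have "\<dots> = avg ?R (\<lambda>r. \<Sum>zs\<in>Y2. loss k (C \<union> S2 zs) \<P> (X2 r zs) (rs @ [r]))"
    by (simp only: avg_sum)
  also have "\<dots> \<le> real (card Y2) * ?B + ?D / real n ^ d"
    unfolding k_def
    by (intro avg_le finite_strings strings_nonempty Suc.IH fin2 Y2) (use Suc.prems(1) in auto)
  finally have "real q * (\<Sum>ys\<in>Y1. loss (Suc k) (C \<union> S ys) \<P> (X ys) rs)
      \<le> real q * (real (card Y1) * ?B) + ?D / real n ^ d"
    by (simp add: card2 algebra_simps)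
  \<comment> \<open>The exceptional term is a count fixed at the end of the phase, while each round
    multiplies the histories by \<open>q \<ge> n\<close>; going back one round therefore divides it
    by \<open>n\<close>.\<close>
  moreover have "?D / real n ^ d \<le> real q * (?D / real n ^ Suc d)"
  proof -
    have "?D / real n ^ d = real n * (?D / real n ^ Suc d)" using n_pos by simp
    also have "\<dots> \<le> real q * (?D / real n ^ Suc d)"
      using q by (intro mult_right_mono) auto
    finally show ?thesis .
  qed
  ultimately have "real q * (\<Sum>ys\<in>Y1. loss (Suc k) (C \<union> S ys) \<P> (X ys) rs)
      \<le> real q * (real (card Y1) * ?B + ?D / real n ^ Suc d)"
    unfolding distrib_left by linarith
  then have Y1: "(\<Sum>ys\<in>Y1. loss (Suc k) (C \<union> S ys) \<P> (X ys) rs)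
      \<le> real (card Y1) * ?B + ?D / real n ^ Suc d"
    using q n_pos by (subst (asm) mult_le_cancel_left_pos) auto

  have sub: "Y1 \<subseteq> Y" by (auto simp: Y1_def)
  have "(\<Sum>ys\<in>Y. loss (Suc k) (C \<union> S ys) \<P> (X ys) rs)
      = (\<Sum>ys\<in>Y - Y1. loss (Suc k) (C \<union> S ys) \<P> (X ys) rs) +
        (\<Sum>ys\<in>Y1. loss (Suc k) (C \<union> S ys) \<P> (X ys) rs)"
    by (rule sum.subset_diff[OF sub Suc.prems(2)])
  also have "(\<Sum>ys\<in>Y - Y1. loss (Suc k) (C \<union> S ys) \<P> (X ys) rs) \<le> real (card (Y - Y1)) * ?B"
    using hit by (rule sum_bounded_above)
  also have "real (card (Y - Y1)) = real (card Y) - real (card Y1)"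
    using card_Diff_subset[OF fin1 sub] card_mono[OF Suc.prems(2) sub] by simp
  finally show ?case
    using Y1 unfolding k(1) by (simp add: algebra_simps)
qed

text \<open>Strong induction on the rounds left: if \<open>h + card \<P> = H\<close>, the endgame
  applies, otherwise one phase is played. The bound on \<open>n - k\<close> is a budget of rounds,
  raised by \<open>K\<close> whenever a pair is created or resolved.\<close>

lemma loss_le_bound:
  assumes "k \<le> n" "cube n K C \<P>" "length x = m" "scenario_size C \<P> = 2 * (n - k)"
    and "n - k \<le> K * (2 * h + card \<P>)" "h + card \<P> \<le> H"
  shows "loss k C \<P> x rs \<le> loss_bound k (card \<P>) h"
  using assms
proof (induction k arbitrary: C \<P> x rs h rule: less_induct)
  case (less k)
  show ?case
  proof (cases "h + card \<P> = H")
    case True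
    have "loss k C \<P> x rs \<le> 1" by (rule endgame[OF less.prems(2,3,1,4)])
    also have "1 = (2::real) ^ card \<P> * (1 / 2) ^ (H - h)"
      using True by (auto simp: power_divide)
    also have "\<dots> \<le> loss_bound k (card \<P>) h"
      unfolding loss_bound_def using err_nonneg by (intro mult_left_mono) auto
    finally show ?thesis .
  next
    case False
    then have lt: "h + card \<P> < H" using less.prems(6) by simp
    \<comment> \<open>From \<open>2 * h + card \<P> \<le> 2 * (H - 1)\<close> it follows that a
      whole phase still fits into the game.\<close>
    have "K * (2 * h + card \<P>) \<le> K * (2 * (H - 1))" using lt by (intro mult_left_mono) auto
    also have "\<dots> = 2 * H * K - 2 * K" by (simp add: algebra_simps diff_mult_distrib2)
    also have "\<dots> \<le> n - K" using n_eq HK_pos by simp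
    finally have "n - k \<le> n - K" using less.prems(5) by linarith
    moreover have "K \<le> n" using n_eq HK_pos by (cases H) auto
    ultimately have K: "K \<le> k" using less.prems(1) by linarith
    \<comment> \<open>The phase starts from the one empty history, so the sum is the loss of the
      cube itself.\<close>
    have "(\<Sum>ys\<in>{[] :: nat list}. loss (k - 0) (C \<union> {}) \<P> x rs)
      \<le> real (card {[] :: nat list}) * loss_bound (k - 1) (card \<P>) h +
        2 ^ card \<P> * (2 ^ m * (2 * real n + 1) * (2 * real K) ^ K) / real n ^ K"
    proof (rule phase[where ?k0.0 = k and t = 0 and S = "\<lambda>_. {}" and X = "\<lambda>_. x"])
      fix k' C' \<P>' h' and x' :: "bool list" and rs'
      assume "k' < k" "cube n K C' \<P>'" "length x' = m" "scenario_size C' \<P>' = 2 * (n - k')"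
        "n - k' \<le> K * (2 * h' + card \<P>')" "h' + card \<P>' \<le> H"
      then show "loss k' C' \<P>' x' rs' \<le> loss_bound k' (card \<P>') h'"
        using less.IH less.prems(1) by simp
    qed (use less.prems lt K in auto)
    also have "2 ^ card \<P> * (2 ^ m * (2 * real n + 1) * (2 * real K) ^ K) / real n ^ K
        = 2 ^ card \<P> * err"
    proof -
      have "2 * real K / real n = 1 / (2 * real H)" using n_eq HK_pos by (simp add: field_simps)
      then have ratio: "(2 * real K) ^ K / real n ^ K = 1 / (2 * real H) ^ K"
        by (metis power_divide power_one)
      show ?thesis
        unfolding err_def times_divide_eq_right[symmetric] ratio by simp
    qed
    \<comment> \<open>The error of this phase is charged to one round, which turns
      \<open>k - 1\<close> into \<open>k\<close>.\<close>
    also have "real (card {[] :: nat list}) * loss_bound (k - 1) (card \<P>) h + 2 ^ card \<P> * err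
        = loss_bound k (card \<P>) h"
      using K HK_pos by (simp add: loss_bound_def algebra_simps of_nat_diff)
    finally show ?thesis by simp
  qed
qed

text \<open>The start of the game is the cube without pairs in which nothing was named; its loss is
  a single term.\<close>

lemma win_prob_start: "1 - (1 / 2) ^ H - err * real n \<le> win_prob n A n (init_state A) {} []"
proof -
  have "loss n {} {} (init_state A) [] \<le> loss_bound n 0 0"
    using loss_le_bound[of n "{}" "{}" "init_state A" 0 "[]"] valid
    by (simp add: cube_def scenario_size_def valid_alice_def)
  then show ?thesis
    by (simp add: loss_def loss_bound_def scenario_def)
qed

end

section \<open>Decay of the error and the final estimate\<close>

lemma negligible_geometric:
  fixes \<gamma> :: real
  assumes "0 < \<gamma>" "\<gamma> < 1"
  shows "negligible_fun (\<lambda>n. real n * (2 * real n + 1) * \<gamma> ^ (2 * n))"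
  unfolding negligible_fun_def
proof (intro allI impI)
  fix c :: nat
  have "(\<lambda>n. real n powr real c * (real n * (2 * real n + 1) * \<gamma> ^ (2 * n))) \<longlonglongrightarrow> 0"
    using assms by real_asymp
  then have "\<forall>\<^sub>F n in sequentially. real n powr real c * (real n * (2 * real n + 1) * \<gamma> ^ (2 * n)) < 1"
    by (rule order_tendstoD) simp
  then obtain N where N: "\<And>n. n \<ge> N \<Longrightarrow> real n powr real c * (real n * (2 * real n + 1) * \<gamma> ^ (2 * n)) < 1"
    by (auto simp: eventually_sequentially)
  show "\<exists>N. \<forall>n>N. \<bar>real n * (2 * real n + 1) * \<gamma> ^ (2 * n)\<bar> < real n powr - real c"
  proof (intro exI allI impI)
    fix n :: nat assume n: "n > N"
    then have "0 < real n powr real c" by simp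
    then show "\<bar>real n * (2 * real n + 1) * \<gamma> ^ (2 * n)\<bar> < real n powr - real c"
      using N[of n] n assms by (simp add: powr_minus field_simps abs_mult)
  qed
qed

theorem theorem4p9:
  fixes c :: nat and \<alpha> \<beta> \<delta> :: real
  assumes "c \<ge> 2" and "even c"
    and "\<alpha> = (1 / real c) powr (1 / (4 * real c))"
    and "\<alpha> < \<beta>" and "\<beta> < 1"
    and "0 < \<delta>" and "\<delta> < 1"
    and "2 powr \<delta> * \<beta> < 1"
  shows "\<exists>\<nu> :: nat \<Rightarrow> real. negligible_fun \<nu> \<and>
    (\<forall>(n::nat) (m::nat) A.
       even n \<longrightarrow> c dvd n \<longrightarrow> even (n div c) \<longrightarrow>
       real m \<le> \<delta> * (2 * real n) \<longrightarrow> valid_alice n m A \<longrightarrow>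
       (\<exists>B. valid_bob n B \<and>
          prob_alice_loses n A B
            \<ge> 1 - ((real n + 1) / (2 * real n + 1)) ^ (c div 2) - \<nu> n))"
proof -
  \<comment> \<open>The factor \<open>2 powr \<delta>\<close> measures Alice's memory and
    \<open>\<alpha>\<close> the scarcity of collisions: \<open>2 ^ m / c ^ K\<close> is at most
    \<open>\<gamma> ^ (2 * n)\<close>.\<close>
  define \<gamma> where "\<gamma> = 2 powr \<delta> * \<alpha>"
  have \<alpha>: "0 < \<alpha>" using assms(1,3) by simp
  have \<gamma>: "0 < \<gamma>" "\<gamma> < 1"
  proof -
    show "0 < \<gamma>" using \<alpha> by (simp add: \<gamma>_def)
    have "\<gamma> \<le> 2 powr \<delta> * \<beta>" unfolding \<gamma>_def using assms(4) by (intro mult_left_mono) auto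
    then show "\<gamma> < 1" using assms(8) by simp
  qed
  \<comment> \<open>The factor \<open>real n\<close> allows for a failed phase in every round;
    \<open>2 * real n + 1\<close> bounds the sets that are never confused.\<close>
  define \<nu> where "\<nu> = (\<lambda>n. real n * (2 * real n + 1) * \<gamma> ^ (2 * n))"
  have "\<exists>B. valid_bob n B \<and> prob_alice_loses n A B
      \<ge> 1 - ((real n + 1) / (2 * real n + 1)) ^ (c div 2) - \<nu> n"
    if n: "c dvd n" "even (n div c)" and m: "real m \<le> \<delta> * (2 * real n)" and A: "valid_alice n m A"
    for n m A
  proof -
    define H K where "H = c div 2" and "K = n div c div 2"
    have c: "c = 2 * H" using assms(2) by (simp add: H_def)
    have "n = c * (n div c)" "n div c = 2 * K" using n by (simp_all add: K_def)
    then have nK: "n = 2 * c * K" by simp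
    interpret open_book_phases n m A H K
      using A nK c by unfold_locales simp_all
    have "\<alpha> ^ (2 * n) = 1 / real c ^ K"
    proof -
      have "\<alpha> ^ (2 * n) = \<alpha> powr real (2 * n)" using \<alpha> by (simp only: powr_realpow)
      also have "\<dots> = (1 / real c) powr (1 / (4 * real c) * real (2 * n))"
        by (simp add: assms(3) powr_powr)
      also have "1 / (4 * real c) * real (2 * n) = real K"
        using nK assms(1) by simp
      also have "(1 / real c) powr real K = 1 / real c ^ K"
        using assms(1) by (simp add: powr_realpow power_divide)
      finally show ?thesis .
    qed
    moreover have "(2::real) ^ m \<le> (2 powr \<delta>) ^ (2 * n)"
    proof -
      have "(2::real) ^ m = 2 powr real m" by (simp add: powr_realpow)
      also have "\<dots> \<le> 2 powr (\<delta> * real (2 * n))" using m by simp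
      also have "\<dots> = (2 powr \<delta>) ^ (2 * n)" by (simp only: powr_powr[symmetric] powr_realpow powr_gt_zero)
      finally show ?thesis .
    qed
    ultimately have "2 ^ m / real c ^ K \<le> \<gamma> ^ (2 * n)"
      unfolding \<gamma>_def power_mult_distrib using assms(1) by (simp add: divide_right_mono)
    then have "real n * (2 * real n + 1) * (2 ^ m / real c ^ K) \<le> \<nu> n"
      unfolding \<nu>_def by (intro mult_left_mono) auto
    then have err: "err * real n \<le> \<nu> n"
      by (simp add: err_def c algebra_simps)
    \<comment> \<open>Each exploited pair fails with probability \<open>1 / 2\<close>, which is at
      most \<open>(n + 1) / (2 * n + 1)\<close>.\<close>
    have "(1 / 2) ^ H \<le> ((real n + 1) / (2 * real n + 1)) ^ H"
      by (intro power_mono) (simp_all add: field_simps)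
    then have "1 - ((real n + 1) / (2 * real n + 1)) ^ H - \<nu> n \<le> win_prob n A n (init_state A) {} []"
      using win_prob_start err by linarith
    also have "\<dots> \<le> prob_alice_loses n A (greedy_bob n A)"
      by (rule prob_greedy_bob[OF n_pos])
    finally show ?thesis
      using valid_greedy_bob[OF n_pos] unfolding H_def by blast
  qed
  moreover have "negligible_fun \<nu>"
    unfolding \<nu>_def by (rule negligible_geometric[OF \<gamma>])
  ultimately show ?thesis by blast
qed

end
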